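(* Let $n \geq 2$, let $V=\prod_{i\in I}V_i/\mathcal F$ be a pseudo-finite set, and let $E \subseteq V^n$ be a definable subset that is symmetric (closed under permutations of the coordinates). Assume that the partitioned formula $E(x_1; x_2,\ldots,x_n)$ is stable, i.e. there is some $m\in\mathbb{N}$ such that there are no $a_1,\ldots,a_m \in V$ and $\bar b_1,\ldots,\bar b_m \in V^{n-1}$ with the property that, for all $i,j\in\{1,\ldots,m\}$, $(a_i,\bar b_j)\in E$ if and only if $i<j$. Then there is a definable set $A\subseteq V$ with $\delta(A)>0$ such that either $(a_1,\ldots,a_n)\in E$ for all pairwise distinct $a_1,\ldots,a_n\in A$, or $(a_1,\ldots,a_n)\notin E$ for all pairwise distinct $a_1,\ldots,a_n\in A$.
   Context: A pseudo-finite set $V$ is an infinite set that is an ultraproduct $V=\prod_{i\in I}V_i/\mathcal F$ of finite sets $V_i$, $i\in I$, with respect to a non-principal ultrafilter $\mathcal F$ on $I$. A subset $A\subseteq V^k$ is definable (i.e. internal) if $A=\prod_{i\in I}A_i/\mathcal F$ for some $A_i\subseteq V_i^k$. For a non-empty definable $A\subseteq V$, the dimension $\delta(A)\in[0,1]$ is the standard part of $\log(|A|)/\log(|V|)$. Explicitly, write $A=\prod_{i\in I}A_i/\mathcal F$ with each $A_i$ a non-empty subset of $V_i$, and let $l_i=\log(|A_i|)/\log(|V_i|)$; then $\delta(A)$ is the unique $l\in[0,1]$ such that for every real $\varepsilon>0$ the set $\{i\in I : l-\varepsilon<l_i<l+\varepsilon\}$ belongs to $\mathcal F$. (Since $V$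 is infinite, $|V_i|\ge 2$ for $\mathcal F$-almost all $i$, so $l_i$ is defined for $\mathcal F$-almost all $i$.) Set $\delta(\emptyset):=-\infty$. *)

theory Defs
  imports "HOL-Analysis.Analysis" "HOL-Library.NList" "HOL-Combinatorics.Permutations"
begin

text \<open>The index set is the type \<open>'i\<close>; a set of indices belongs to the
  ultrafilter when its membership predicate holds eventually.\<close>

definition ultrafilter :: "'i filter \<Rightarrow> bool" where
  "ultrafilter F \<longleftrightarrow>
     F \<noteq> bot \<and> (\<forall>P. eventually P F \<or> eventually (\<lambda>i. \<not> P i) F)"

definition nonprincipal :: "'i filter \<Rightarrow> bool" where
  "nonprincipal F \<longleftrightarrow> (\<forall>j. \<not> eventually (\<lambda>i. i = j) F)"

definition ae_eq :: "'i filter \<Rightarrow> (('i \<Rightarrow> 'a) \<times> ('i \<Rightarrow> 'a)) set" where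
  "ae_eq F = {(f, g). eventually (\<lambda>i. f i = g i) F}"

text \<open>Membership in the factors is required only \<open>F\<close>-almost everywhere. If all factors
  are non-empty, these are exactly the classes of the choice functions in their product;
  if some factors are empty, this is the ultraproduct over an index set in \<open>F\<close> on which they
  are not, rather than the quotient of an empty product.\<close>

definition ultraproduct :: "'i filter \<Rightarrow> ('i \<Rightarrow> 'a set) \<Rightarrow> ('i \<Rightarrow> 'a) set set" where
  "ultraproduct F A = {f. eventually (\<lambda>i. f i \<in> A i) F} // ae_eq F"

definition pseudo_finite :: "'i filter \<Rightarrow> ('i \<Rightarrow> 'a set) \<Rightarrow> bool" where
  "pseudo_finite F V \<longleftrightarrow>
     ultrafilter F \<and> nonprincipal F \<and> (\<forall>i. finite (V i)) \<and> infinite (ultraproduct F V)"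

definition definable :: "'i filter \<Rightarrow> ('i \<Rightarrow> 'a set) \<Rightarrow> ('i \<Rightarrow> 'a) set set \<Rightarrow> bool" where
  "definable F V A \<longleftrightarrow> (\<exists>B. (\<forall>i. B i \<subseteq> V i) \<and> A = ultraproduct F B)"

text \<open>A \<open>k\<close>-tuple is a list of length \<open>k\<close>. For sets \<open>B i\<close> of \<open>k\<close>-tuples, the following is
  their ultraproduct, transported along the identification of the class of a family of
  tuples with the tuple of the classes of its coordinates.\<close>

definition ultraproduct_tuples ::
    "'i filter \<Rightarrow> nat \<Rightarrow> ('i \<Rightarrow> 'a list set) \<Rightarrow> ('i \<Rightarrow> 'a) set list set" where
  "ultraproduct_tuples F k B =
     {map (\<lambda>f. ae_eq F `` {f}) fs | fs.
        length fs = k \<and> eventually (\<lambda>i. map (\<lambda>f. f i) fs \<in> B i) F}"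

definition definable_tuples ::
    "'i filter \<Rightarrow> ('i \<Rightarrow> 'a set) \<Rightarrow> nat \<Rightarrow> ('i \<Rightarrow> 'a) set list set \<Rightarrow> bool" where
  "definable_tuples F V k A \<longleftrightarrow>
     (\<exists>B. (\<forall>i. B i \<subseteq> nlists k (V i)) \<and> A = ultraproduct_tuples F k B)"

text \<open>The dimension of a non-empty definable set does not depend on the chosen
  representation \<open>B\<close>; existence and uniqueness are proved below. The sets \<open>B i\<close> are
  non-empty for almost all \<open>i\<close> because \<open>A\<close> is non-empty. Convergence along the ultrafilter
  expresses the standard part.\<close>

definition udim_rel ::
    "'i filter \<Rightarrow> ('i \<Rightarrow> 'a set) \<Rightarrow> ('i \<Rightarrow> 'a) set set \<Rightarrow> real \<Rightarrow> bool" where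
  "udim_rel F V A l \<longleftrightarrow>
     0 \<le> l \<and> l \<le> 1 \<and>
     (\<exists>B. (\<forall>i. B i \<subseteq> V i) \<and> A = ultraproduct F B \<and>
          ((\<lambda>i. ln (real (card (B i))) / ln (real (card (V i)))) \<longlongrightarrow> l) F)"

definition udim ::
    "'i filter \<Rightarrow> ('i \<Rightarrow> 'a set) \<Rightarrow> ('i \<Rightarrow> 'a) set set \<Rightarrow> ereal" where
  "udim F V A = (if A = {} then -\<infinity> else ereal (THE l. udim_rel F V A l))"

definition symmetric_tuples :: "'b list set \<Rightarrow> bool" where
  "symmetric_tuples E \<longleftrightarrow>
     (\<forall>xs\<in>E. \<forall>\<sigma>. \<sigma> permutes {..<length xs} \<longrightarrow> permute_list \<sigma> xs \<in> E)"

text \<open>Stability of \<open>E(x\<^sub>1; x\<^sub>2, \<dots>, x\<^sub>n)\<close>, for a relation \<open>E\<close> on \<open>n\<close>-tuples from \<open>V\<close>.\<close>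

definition stable_partitioned :: "'b set \<Rightarrow> nat \<Rightarrow> 'b list set \<Rightarrow> bool" where
  "stable_partitioned V n E \<longleftrightarrow>
     (\<exists>m. \<nexists>a b. (\<forall>i\<in>{1..m}. a i \<in> V) \<and> (\<forall>j\<in>{1..m}. b j \<in> nlists (n - 1) V) \<and>
        (\<forall>i\<in>{1..m::nat}. \<forall>j\<in>{1..m}. a i # b j \<in> E \<longleftrightarrow> i < j))"

lemma equiv_ae_eq: "equiv UNIV (ae_eq F)"
proof (rule equivI)
  show "refl (ae_eq F)" by (auto simp: refl_on_def ae_eq_def)
  show "sym (ae_eq F)" by (auto simp: sym_def ae_eq_def eq_commute)
  show "trans (ae_eq F)"
    unfolding trans_def ae_eq_def by (auto elim: eventually_elim2)
qed auto

lemma class_in_ultraproduct_iff: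
  "ae_eq F `` {f} \<in> ultraproduct F A \<longleftrightarrow> eventually (\<lambda>i. f i \<in> A i) F"
proof
  assume "ae_eq F `` {f} \<in> ultraproduct F A"
  then obtain g where g: "eventually (\<lambda>i. g i \<in> A i) F" "ae_eq F `` {f} = ae_eq F `` {g}"
    unfolding ultraproduct_def quotient_def by auto
  then have "(f, g) \<in> ae_eq F"
    using eq_equiv_class_iff[OF equiv_ae_eq] by blast
  then have "eventually (\<lambda>i. f i = g i) F" by (simp add: ae_eq_def)
  with g(1) show "eventually (\<lambda>i. f i \<in> A i) F" by (rule eventually_elim2) simp
qed (auto simp: ultraproduct_def quotient_def)

lemma ultraproduct_subset_imp:
  assumes F: "ultrafilter F" and sub: "ultraproduct F B \<subseteq> ultraproduct F C"
    and ne: "ultraproduct F B \<noteq> {}"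
  shows "eventually (\<lambda>i. B i \<subseteq> C i) F"
proof (rule ccontr)
  assume "\<not> ?thesis"
  then have N: "eventually (\<lambda>i. \<not> B i \<subseteq> C i) F"
    using F by (auto simp: ultrafilter_def)
  define f where "f i = (SOME x. x \<in> B i \<and> x \<notin> C i)" for i
  have f: "f i \<in> B i \<and> f i \<notin> C i" if "\<not> B i \<subseteq> C i" for i
    unfolding f_def by (rule someI_ex) (use that in blast)
  have 1: "eventually (\<lambda>i. f i \<in> B i) F" and 2: "eventually (\<lambda>i. f i \<notin> C i) F"
    using N f by (blast intro: eventually_mono)+
  have "eventually (\<lambda>i. f i \<in> C i) F"
    using 1 sub class_in_ultraproduct_iff[of F f] by blast
  with 2 have "eventually (\<lambda>i. False) F" by (rule eventually_elim2) simp
  then show False using F by (simp add: ultrafilter_def)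
qed

lemma udim_rel_unique:
  assumes "ultrafilter F" "A \<noteq> {}" "udim_rel F V A l" "udim_rel F V A l'"
  shows "l = l'"
proof -
  let ?r = "\<lambda>B i. ln (real (card (B i))) / ln (real (card (V i)))"
  obtain B C where B: "A = ultraproduct F B" "(?r B \<longlongrightarrow> l) F"
    and C: "A = ultraproduct F C" "(?r C \<longlongrightarrow> l') F"
    using assms(3,4) unfolding udim_rel_def by blast
  have "eventually (\<lambda>i. B i \<subseteq> C i) F" "eventually (\<lambda>i. C i \<subseteq> B i) F"
    using assms(1,2) B(1) C(1) by (auto intro: ultraproduct_subset_imp)
  then have "eventually (\<lambda>i. ?r B i = ?r C i) F"
    by (rule eventually_elim2) (metis subset_antisym)
  then have "(?r C \<longlongrightarrow> l) F"
    using B(2) by (rule Lim_transform_eventually[rotated])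
  then show ?thesis
    using C(2) assms(1) tendsto_unique unfolding ultrafilter_def by blast
qed

lemma ultrafilter_tendsto_compact:
  fixes f :: "'i \<Rightarrow> real"
  assumes F: "ultrafilter F" and K: "compact K" and ev: "eventually (\<lambda>i. f i \<in> K) F"
  obtains l where "l \<in> K" "(f \<longlongrightarrow> l) F"
proof -
  have "filtermap f F \<noteq> bot" using F by (simp add: ultrafilter_def filtermap_bot_iff)
  moreover have "eventually (\<lambda>x. x \<in> K) (filtermap f F)"
    using ev by (simp add: eventually_filtermap)
  ultimately obtain l where l: "l \<in> K" "inf (nhds l) (filtermap f F) \<noteq> bot"
    using K unfolding compact_filter by blast
  have "(f \<longlongrightarrow> l) F"
    unfolding tendsto_def
  proof (intro allI impI)
    fix S assume S: "open S" "l \<in> S"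
    show "eventually (\<lambda>i. f i \<in> S) F"
    proof (rule ccontr)
      assume "\<not> ?thesis"
      then have "eventually (\<lambda>i. f i \<notin> S) F" using F by (auto simp: ultrafilter_def)
      then have "eventually (\<lambda>x. x \<notin> S) (filtermap f F)" by (simp add: eventually_filtermap)
      moreover have "eventually (\<lambda>x. x \<in> S) (nhds l)" using S by (rule eventually_nhds_in_open)
      ultimately have "eventually (\<lambda>x. False) (inf (nhds l) (filtermap f F))"
        unfolding eventually_inf by blast
      with l(2) show False by (simp add: eventually_False)
    qed
  qed
  with l(1) that show thesis by blast
qed

lemma udim_rel_exists:
  assumes V: "pseudo_finite F V" and A: "definable F V A" "A \<noteq> {}"
  shows "\<exists>!l. udim_rel F V A l"
proof -
  have F: "ultrafilter F" and fin: "finite (V i)" for i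
    using V by (auto simp: pseudo_finite_def)
  obtain B where B: "\<And>i. B i \<subseteq> V i" "A = ultraproduct F B"
    using A(1) unfolding definable_def by blast
  let ?r = "\<lambda>i. ln (real (card (B i))) / ln (real (card (V i)))"
  obtain f where f: "eventually (\<lambda>i. f i \<in> B i) F"
    using A(2) B(2) unfolding ultraproduct_def quotient_def by blast
  have "?r i \<in> {0..1}" if "f i \<in> B i" for i
  proof -
    have "finite (B i)" using B(1) fin by (rule finite_subset)
    with that have "1 \<le> card (B i)" by (metis One_nat_def Suc_leI card_gt_0_iff empty_iff)
    moreover have "card (B i) \<le> card (V i)" using B(1) fin by (simp add: card_mono)
    ultimately have "0 \<le> ln (real (card (B i)))"
      "ln (real (card (B i))) \<le> ln (real (card (V i)))" by simp_all
    then show ?thesis by (auto simp: divide_le_eq_1)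
  qed
  with f have "eventually (\<lambda>i. ?r i \<in> {0..1}) F" by (auto elim: eventually_mono)
  then obtain l where "l \<in> {0..1}" "(?r \<longlongrightarrow> l) F"
    by (rule ultrafilter_tendsto_compact[OF F compact_Icc])
  then have "udim_rel F V A l" unfolding udim_rel_def using B by auto
  then show ?thesis using udim_rel_unique[OF F A(2)] by blast
qed

lemma udim_eq:
  assumes "pseudo_finite F V" "definable F V A" "A \<noteq> {}" "udim_rel F V A l"
  shows "udim F V A = ereal l"
  using udim_rel_exists[OF assms(1-3)] assms(3,4) unfolding udim_def by (simp add: the1_equality)

end

theory Submission
  imports Defs
begin

text \<open>Everything is proved with explicit exponents in the finite factors and transferred along
  the ultrafilter. If \<open>E(x; y)\<close> has no half graph of size \<open>m\<close>, then binary trees of splittings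
  have bounded height. Walking down such a tree as long as some \<open>b\<close> splits the current set \<open>A\<close>
  into two pieces of size at least \<open>card A powr \<theta>\<close> therefore ends, after boundedly many steps,
  in a set \<open>A\<close> of size at least a fixed power of \<open>card V\<close> on which every \<open>(n-1)\<close>-tuple \<open>b\<close> has a
  majority type. The set \<open>F\<close> of those \<open>b\<close> with \<open>a # b \<in> E\<close> for most \<open>a\<close> is symmetric of arity
  \<open>n - 1\<close>, and by inserting one generic \<open>a \<in> A\<close> a half graph for \<open>F\<close> becomes one for \<open>E\<close>. By
  induction on the arity, \<open>F\<close> has a large homogeneous subset of \<open>A\<close>; inside it every tuple has
  few exceptional extensions, so a maximal homogeneous set for \<open>E\<close> is large.\<close>

text \<open>Together with \<open>nlists_def\<close> these make the simplifier loop.\<close>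

declare nlistsE_length [simp del] nlistsE_set [simp del]

section \<open>Half graphs and splitting trees\<close>

text \<open>The configuration that \<open>stable_partitioned\<close> forbids. Relation and sides are
  parameters because the induction on the arity changes all of them while \<open>m\<close> stays
  fixed.\<close>

definition half_graph :: "('a \<Rightarrow> 'b \<Rightarrow> bool) \<Rightarrow> 'a set \<Rightarrow> 'b set \<Rightarrow> nat \<Rightarrow> bool" where
  "half_graph R X Y m \<longleftrightarrow>
     (\<exists>a b. (\<forall>i\<in>{1..m}. a i \<in> X) \<and> (\<forall>j\<in>{1..m}. b j \<in> Y) \<and>
        (\<forall>i\<in>{1..m}. \<forall>j\<in>{1..m}. R (a i) (b j) \<longleftrightarrow> i < j))"

lemma half_graphD:
  assumes "half_graph R X Y m"
  obtains a b where "\<And>i. i \<in> {1..m} \<Longrightarrow> a i \<in> X" "\<And>j. j \<in> {1..m} \<Longrightarrow> b j \<in> Y"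
    "\<And>i j. i \<in> {1..m} \<Longrightarrow> j \<in> {1..m} \<Longrightarrow> R (a i) (b j) \<longleftrightarrow> i < j"
proof -
  from assms obtain a b where "(\<forall>i\<in>{1..m}. a i \<in> X) \<and> (\<forall>j\<in>{1..m}. b j \<in> Y) \<and>
      (\<forall>i\<in>{1..m}. \<forall>j\<in>{1..m}. R (a i) (b j) \<longleftrightarrow> i < j)"
    unfolding half_graph_def by (elim exE)
  then show thesis by (intro that[of a b]) simp_all
qed

lemma half_graphI:
  assumes "\<And>i. i \<in> {1..m} \<Longrightarrow> a i \<in> X" "\<And>j. j \<in> {1..m} \<Longrightarrow> b j \<in> Y"
    "\<And>i j. i \<in> {1..m} \<Longrightarrow> j \<in> {1..m} \<Longrightarrow> R (a i) (b j) \<longleftrightarrow> i < j"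
  shows "half_graph R X Y m"
  unfolding half_graph_def by (intro exI[of _ a] exI[of _ b] conjI ballI assms)

lemma half_graph_mono:
  assumes "half_graph R X Y m" "X \<subseteq> X'" "Y \<subseteq> Y'"
  shows "half_graph R X' Y' m"
proof (rule half_graphD[OF assms(1)])
  fix a b
  assume ab: "\<And>i. i \<in> {1..m} \<Longrightarrow> a i \<in> X" "\<And>j. j \<in> {1..m} \<Longrightarrow> b j \<in> Y"
    "\<And>i j. i \<in> {1..m} \<Longrightarrow> j \<in> {1..m} \<Longrightarrow> R (a i) (b j) \<longleftrightarrow> i < j"
  show ?thesis
    by (rule half_graphI[of m a X' b Y' R])
      (erule subsetD[OF assms(2) ab(1)] subsetD[OF assms(3) ab(2)] ab(3), assumption?)+
qed

text \<open>\<open>splits R Y h A\<close>: the formula \<open>R\<close> with parameters from \<open>Y\<close> has Shelah 2-rank at least \<open>h\<close>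
  on \<open>A\<close>.\<close>

fun splits :: "('a \<Rightarrow> 'b \<Rightarrow> bool) \<Rightarrow> 'b set \<Rightarrow> nat \<Rightarrow> 'a set \<Rightarrow> bool" where
  "splits R Y 0 A \<longleftrightarrow> A \<noteq> {}"
| "splits R Y (Suc h) A \<longleftrightarrow>
     (\<exists>b\<in>Y. splits R Y h {a\<in>A. R a b} \<and> splits R Y h {a\<in>A. \<not> R a b})"

lemma splits_mono: "splits R Y h A \<Longrightarrow> A \<subseteq> A' \<Longrightarrow> splits R Y h A'"
proof (induction h arbitrary: A A')
  case (Suc h)
  then obtain b where "b \<in> Y" "splits R Y h {a\<in>A. R a b}" "splits R Y h {a\<in>A. \<not> R a b}"
    by auto
  moreover have "{a\<in>A. R a b} \<subseteq> {a\<in>A'. R a b}" "{a\<in>A. \<not> R a b} \<subseteq> {a\<in>A'. \<not> R a b}"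
    using Suc.prems by auto
  ultimately have "splits R Y h {a\<in>A'. R a b}" "splits R Y h {a\<in>A'. \<not> R a b}"
    using Suc.IH by blast+
  with \<open>b \<in> Y\<close> show ?case by auto
qed auto

lemma splits_nonempty: "splits R Y h A \<Longrightarrow> A \<noteq> {}"
  by (induction h arbitrary: A) auto

text \<open>A Ramsey argument for trees whose nodes are coloured by \<open>B\<close> and
  \<open>C\<close>. The colour of the root decides which of the two heights is lowered in both
  subtrees. Either both return a tree of the root's colour and the root joins them, or one of them
  already contains the other colour at full height.\<close>

lemma splits_Un:
  "splits R (B \<union> C) (p + q) A \<Longrightarrow> splits R B p A \<or> splits R C q A"
proof (induction "p + q" arbitrary: p q A)
  case 0
  then show ?case by simp
next
  case (Suc k)
  have sub: "splits R Y h A" if "splits R Y h {a\<in>A. P a}" for Y h P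
    using that by (rule splits_mono) auto
  show ?case
  \<comment> \<open>A tree of height zero asks only for a non-empty set.\<close>
  proof (cases "p = 0 \<or> q = 0")
    case True
    then show ?thesis using splits_nonempty[OF Suc.prems] by auto
  next
    case False
    then obtain p' q' where pq: "p = Suc p'" "q = Suc q'" by (auto simp: gr0_conv_Suc)
    obtain b where b: "b \<in> B \<union> C" "splits R (B \<union> C) k {a\<in>A. R a b}"
        "splits R (B \<union> C) k {a\<in>A. \<not> R a b}"
      using Suc.prems Suc.hyps(2)[symmetric] by auto
    have k: "k = p' + q" "k = p + q'" using pq Suc.hyps(2) by auto
    show ?thesis
    proof (cases "b \<in> B")
      case True
      have "splits R B p' {a\<in>A. R a b} \<or> splits R C q {a\<in>A. R a b}"
        "splits R B p' {a\<in>A. \<not> R a b} \<or> splits R C q {a\<in>A. \<not> R a b}"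
        using Suc.hyps(1)[of p' q] b k(1) by blast+
      then show ?thesis using sub True pq(1) by auto
    next
      case False
      have "splits R B p {a\<in>A. R a b} \<or> splits R C q' {a\<in>A. R a b}"
        "splits R B p {a\<in>A. \<not> R a b} \<or> splits R C q' {a\<in>A. \<not> R a b}"
        using Suc.hyps(1)[of p q'] b k(2) by blast+
      then show ?thesis using sub False pq(2) b(1) by auto
    qed
  qed
qed

text \<open>Each rung costs a halving of the tree, to make one element uniform on all later
  parameters, and then one level, to pass to the side of the root opposite to that element.\<close>

fun ladder_depth :: "nat \<Rightarrow> nat" where
  "ladder_depth 0 = 0"
| "ladder_depth (Suc k) = Suc (ladder_depth k) + Suc (ladder_depth k)"

text \<open>In a rung \<open>(a, b, s)\<close> the bit \<open>s\<close> is the value of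
  \<open>a\<close> at its own and at all later parameters, while all later elements take the
  opposite value at \<open>b\<close>. Only the bit may still vary from rung to rung.\<close>

lemma splits_ladder:
  "splits R Y (ladder_depth k) A \<Longrightarrow>
   \<exists>xs. length xs = k \<and> (\<forall>(a, b, s)\<in>set xs. a \<in> A \<and> b \<in> Y \<and> R a b = s) \<and>
        sorted_wrt (\<lambda>(a, b, s) (a', b', s'). R a b' = s \<and> R a' b \<noteq> s) xs"
proof (induction k arbitrary: A Y)
  case (Suc k)
  obtain h where h: "h \<in> A" using splits_nonempty[OF Suc.prems] by blast
  \<comment> \<open>Colouring the parameters by their value at \<open>h\<close> yields a tree on one
    colour, on which \<open>h\<close> is constant. Below its root \<open>b\<close>, the side with
    value different from \<open>s\<close> carries the remaining rungs.\<close>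
  define Z where "Z s = {b\<in>Y. R h b = s}" for s
  have "Y = Z True \<union> Z False" unfolding Z_def by auto
  then have "splits R (Z True \<union> Z False) (Suc (ladder_depth k) + Suc (ladder_depth k)) A"
    using Suc.prems by simp
  then obtain s where s: "splits R (Z s) (Suc (ladder_depth k)) A"
    using splits_Un by blast
  then obtain b where b: "b \<in> Z s" "splits R (Z s) (ladder_depth k) {a\<in>A. R a b}"
      "splits R (Z s) (ladder_depth k) {a\<in>A. \<not> R a b}"
    by auto
  then have "splits R (Z s) (ladder_depth k) {a\<in>A. R a b \<noteq> s}" by (cases s) auto
  from Suc.IH[OF this] obtain xs where xs: "length xs = k"
      "\<forall>(a', b', s')\<in>set xs. a' \<in> {a\<in>A. R a b \<noteq> s} \<and> b' \<in> Z s \<and> R a' b' = s'"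
      "sorted_wrt (\<lambda>(a, b, s) (a', b', s'). R a b' = s \<and> R a' b \<noteq> s) xs"
    by blast
  show ?case
    by (rule exI[of _ "(h, b, s) # xs"]) (use xs h b(1) in \<open>auto simp: Z_def\<close>)
qed simp

text \<open>By pigeonhole, \<open>m + 1\<close> of the \<open>2 * m + 2\<close> rungs share a bit.
  On these the relation depends only on the order of the positions, so reindexing gives a half
  graph.\<close>

lemma splits_half_graph:
  assumes "splits R Y (ladder_depth (2 * m + 2)) A"
  shows "half_graph R A Y m"
proof -
  obtain xs where len: "length xs = 2 * m + 2"
    and xs: "\<forall>(a, b, s)\<in>set xs. a \<in> A \<and> b \<in> Y \<and> R a b = s"
      "sorted_wrt (\<lambda>(a, b, s) (a', b', s'). R a b' = s \<and> R a' b \<noteq> s) xs"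
    using splits_ladder[OF assms] by blast
  have "length (filter (\<lambda>x. snd (snd x)) xs) + length (filter (\<lambda>x. \<not> snd (snd x)) xs)
      = 2 * m + 2"
    using sum_length_filter_compl[of "\<lambda>x. snd (snd x)" xs] len by simp
  then have "\<exists>s. length (filter (\<lambda>x. snd (snd x) = s) xs) \<ge> m + 1"
    by (rule_tac ccontr) (auto simp: not_le all_bool_eq)
  then obtain s where s: "length (filter (\<lambda>x. snd (snd x) = s) xs) \<ge> m + 1" by blast
  define ys where "ys = filter (\<lambda>x. snd (snd x) = s) xs"
  define a where "a p = fst (ys ! p)" for p
  define b where "b p = fst (snd (ys ! p))" for p
  have ys_len: "m < length ys" using s unfolding ys_def by simp
  have mem: "a p \<in> A \<and> b p \<in> Y \<and> R (a p) (b p) = s" if "p \<le> m" for p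
  proof -
    have "ys ! p \<in> set ys" using that ys_len by simp
    then show ?thesis using xs(1) unfolding ys_def a_def b_def by fastforce
  qed
  have sorted: "sorted_wrt (\<lambda>(a, b, s) (a', b', s'). R a b' = s \<and> R a' b \<noteq> s) ys"
    using xs(2) unfolding ys_def by (rule sorted_wrt_filter)
  have rel: "R (a p) (b q) = s \<and> R (a q) (b p) \<noteq> s" if "p < q" "q \<le> m" for p q
  proof -
    have "(\<lambda>(a, b, s) (a', b', s'). R a b' = s \<and> R a' b \<noteq> s) (ys ! p) (ys ! q)"
      using sorted that ys_len by (auto simp: sorted_wrt_iff_nth_less)
    moreover have "ys ! p \<in> set ys" using that ys_len by simp
    then have "snd (snd (ys ! p)) = s" unfolding ys_def by auto
    ultimately show ?thesis unfolding a_def b_def by (auto split: prod.splits)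
  qed
  have iff: "R (a p) (b q) = (if p \<le> q then s else \<not> s)" if "p \<le> m" "q \<le> m" for p q
    using rel[of p q] rel[of q p] mem[of p] that by (cases p q rule: linorder_cases) auto
  show ?thesis
  proof (cases s)
    case True
    \<comment> \<open>Here the relation is \<open>p \<le> q\<close>; shifting the parameters by one
      makes it strict.\<close>
    show ?thesis
      by (rule half_graphI[of _ a _ "\<lambda>j. b (j - 1)"]) (use mem iff True in \<open>auto split: if_splits\<close>)
  next
    case False
    \<comment> \<open>Here the relation is \<open>q < p\<close>; reversing both sequences turns it
      around.\<close>
    show ?thesis
      by (rule half_graphI[of _ "\<lambda>i. a (m - i)" _ "\<lambda>j. b (m - j)"]) (use mem iff False in \<open>auto split: if_splits\<close>)
  qed
qed

section \<open>Large sets without balanced splittings\<close>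

text \<open>If \<open>b\<close> splits \<open>V\<close> into two large pieces, at least one of them
  has no tree of height one less. Each passage to such a piece costs a factor \<theta> in the
  exponent, and there are at most \<open>h\<close> of them, since height zero would force the set to
  be empty.\<close>

lemma exists_unsplit_subset:
  fixes \<theta> :: real
  assumes "0 < \<theta>" "\<theta> \<le> 1" "finite V" "V \<noteq> {}" "\<not> splits R Y h V"
  shows "\<exists>A\<subseteq>V. card A \<ge> real (card V) powr (\<theta> ^ h) \<and>
           (\<forall>b\<in>Y. card {a\<in>A. R a b} < real (card A) powr \<theta> \<or>
                   card {a\<in>A. \<not> R a b} < real (card A) powr \<theta>)"
  using assms(3-)
proof (induction h arbitrary: V)
  case (Suc h)
  have V1: "real (card V) \<ge> 1" using Suc.prems by (simp add: Suc_leI card_gt_0_iff)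
  show ?case
  proof (cases "\<forall>b\<in>Y. card {a\<in>V. R a b} < real (card V) powr \<theta> \<or>
                       card {a\<in>V. \<not> R a b} < real (card V) powr \<theta>")
    case True
    have "\<theta> ^ Suc h \<le> 1" using assms by (intro power_le_one) auto
    then have "real (card V) powr (\<theta> ^ Suc h) \<le> real (card V) powr 1"
      using V1 by (intro powr_mono) auto
    then show ?thesis using True V1 by (intro exI[of _ V]) auto
  next
    case False
    then obtain b where b: "b \<in> Y" "card {a\<in>V. R a b} \<ge> real (card V) powr \<theta>"
        "card {a\<in>V. \<not> R a b} \<ge> real (card V) powr \<theta>"
      by (auto simp: not_less)
    have "\<not> splits R Y h {a\<in>V. R a b} \<or> \<not> splits R Y h {a\<in>V. \<not> R a b}"
      using Suc.prems(3) b(1) by auto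
    then obtain W where W: "W \<subseteq> V" "card W \<ge> real (card V) powr \<theta>" "\<not> splits R Y h W"
    proof
      assume "\<not> splits R Y h {a\<in>V. R a b}"
      then show thesis using b(2) that[of "{a\<in>V. R a b}"] by simp
    next
      assume "\<not> splits R Y h {a\<in>V. \<not> R a b}"
      then show thesis using b(3) that[of "{a\<in>V. \<not> R a b}"] by simp
    qed
    have "real (card V) powr \<theta> > 0" using V1 by simp
    with W(2) have "card W \<noteq> 0" by (metis not_le of_nat_0)
    then have ne: "W \<noteq> {}" by auto
    have "finite W" using W(1) Suc.prems(1) finite_subset by blast
    from Suc.IH[OF this ne W(3)] obtain A where A: "A \<subseteq> W"
        "card A \<ge> real (card W) powr (\<theta> ^ h)"
        "\<forall>b\<in>Y. card {a\<in>A. R a b} < real (card A) powr \<theta> \<or>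
                card {a\<in>A. \<not> R a b} < real (card A) powr \<theta>"
      by blast
    have "real (card V) powr (\<theta> ^ Suc h) = (real (card V) powr \<theta>) powr (\<theta> ^ h)"
      by (simp add: powr_powr)
    also have "\<dots> \<le> real (card W) powr (\<theta> ^ h)"
      using W(2) assms(1) by (intro powr_mono2) auto
    finally show ?thesis using A W(1) by (intro exI[of _ A]) auto
  qed
qed auto

section \<open>Symmetric relations and greedy homogeneous sets\<close>

text \<open>Multiset equality replaces index permutations, so that moving a single entry through a
  list needs no explicit permutation.\<close>

definition symmetric_rel :: "'a list set \<Rightarrow> bool" where
  "symmetric_rel E \<longleftrightarrow> (\<forall>xs ys. mset xs = mset ys \<longrightarrow> xs \<in> E \<longrightarrow> ys \<in> E)"

lemma symmetric_relD: "symmetric_rel E \<Longrightarrow> mset xs = mset ys \<Longrightarrow> xs \<in> E \<longleftrightarrow> ys \<in> E"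
  unfolding symmetric_rel_def by metis

lemma symmetric_rel_Compl: "symmetric_rel E \<Longrightarrow> symmetric_rel (- E)"
  unfolding symmetric_rel_def by (metis ComplD ComplI)

definition all_tuples_in :: "nat \<Rightarrow> 'a list set \<Rightarrow> 'a set \<Rightarrow> bool" where
  "all_tuples_in n E A \<longleftrightarrow> (\<forall>as\<in>nlists n A. distinct as \<longrightarrow> as \<in> E)"

lemma finite_nlists: "finite A \<Longrightarrow> finite (nlists n A)"
  using finite_lists_length_eq[of A n] unfolding nlists_def by (simp add: conj_commute)

lemma card_nlists: "finite A \<Longrightarrow> card (nlists n A) = card A ^ n"
  using card_lists_length_eq[of A n] unfolding nlists_def by (simp add: conj_commute)

lemma all_tuples_in_insert:
  assumes sym: "symmetric_rel E" and S: "all_tuples_in (Suc n) E S"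
    and x: "x \<notin> S" "\<And>b. b \<in> nlists n S \<Longrightarrow> distinct b \<Longrightarrow> x # b \<in> E"
  shows "all_tuples_in (Suc n) E (insert x S)"
  unfolding all_tuples_in_def
proof (intro ballI impI)
  fix as assume as: "as \<in> nlists (Suc n) (insert x S)" "distinct as"
  show "as \<in> E"
  proof (cases "x \<in> set as")
    case False
    then have "as \<in> nlists (Suc n) S" using as(1) by (simp add: nlists_def subset_insert)
    then show ?thesis using S as(2) by (simp add: all_tuples_in_def)
  next
    case True
    from split_list[OF True] obtain us vs where uv: "as = us @ x # vs" by (elim exE)
    \<comment> \<open>Distinctness excludes a second \<open>x\<close>, so the remaining entries all
      come from \<open>S\<close>.\<close>
    then have "us @ vs \<in> nlists n S" "distinct (us @ vs)"
      using as by (auto simp: nlists_def)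
    then have "x # us @ vs \<in> E" by (rule x(2))
    then show ?thesis using symmetric_relD[OF sym, of "x # us @ vs" as] uv by simp
  qed
qed

text \<open>Take \<open>S\<close> maximal. A point outside \<open>S\<close> cannot be added, so it
  is exceptional for some tuple from \<open>S\<close>. Hence \<open>A\<close> is covered by
  \<open>S\<close> and at most \<open>card S ^ n\<close> exceptional sets of size at most
  \<open>s\<close>.\<close>

lemma greedy_all_tuples_in:
  fixes s :: real
  assumes n: "n \<ge> 1" and fin: "finite A" and ne: "A \<noteq> {}" and sym: "symmetric_rel E"
    and s: "s \<ge> 0"
    and small: "\<And>b. b \<in> nlists n A \<Longrightarrow> distinct b \<Longrightarrow> card {a\<in>A. a # b \<notin> E} \<le> s"
  shows "\<exists>S\<subseteq>A. all_tuples_in (Suc n) E S \<and> S \<noteq> {} \<and> card A \<le> card S + real (card S) ^ n * s"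
proof -
  let ?\<S> = "{S. S \<subseteq> A \<and> all_tuples_in (Suc n) E S \<and> S \<noteq> {}}"
  obtain x where x: "x \<in> A" using ne by blast
  \<comment> \<open>Since \<open>n \<ge> 1\<close>, the tuples have at least two entries, so a
    singleton qualifies vacuously and the maximal set can be taken non-empty.\<close>
  have "\<not> distinct as" if "as \<in> nlists (Suc n) {x}" for as
    using that n by (auto simp: nlists_singleton)
  then have "all_tuples_in (Suc n) E {x}" unfolding all_tuples_in_def by blast
  with x have "{x} \<in> ?\<S>" by auto
  then have ne\<S>: "?\<S> \<noteq> {}" by (metis (lifting) empty_iff)
  have fin\<S>: "finite ?\<S>" using fin by simp
  from finite_has_maximal[OF fin\<S> ne\<S>]
  obtain S where S: "S \<in> ?\<S>" "\<forall>T\<in>?\<S>. S \<subseteq> T \<longrightarrow> S = T"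
    by (elim bexE) (rule that)
  have finS: "finite S" using S(1) fin finite_subset by blast
  let ?B = "{b \<in> nlists n S. distinct b}"
  have finB: "finite ?B" using finite_nlists[OF finS] by simp
  have sub: "A \<subseteq> S \<union> (\<Union>b\<in>?B. {a\<in>A. a # b \<notin> E})"
  proof
    fix y assume y: "y \<in> A"
    show "y \<in> S \<union> (\<Union>b\<in>?B. {a\<in>A. a # b \<notin> E})"
    proof (cases "y \<in> S")
      case False
      then have "insert y S \<notin> ?\<S>" using bspec[OF S(2), of "insert y S"] by auto
      then have "\<not> all_tuples_in (Suc n) E (insert y S)" using S(1) y by auto
      moreover have "all_tuples_in (Suc n) E S" using S(1) by simp
      ultimately have "\<exists>b\<in>?B. y # b \<notin> E"
        using all_tuples_in_insert[OF sym _ False, of n] by auto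
      then show ?thesis using y by simp
    qed simp
  qed
  have small': "real (card {a\<in>A. a # b \<notin> E}) \<le> s" if "b \<in> ?B" for b
    using that S(1) nlists_mono[of S A n] by (intro small) auto
  have "card ?B \<le> card (nlists n S)"
    by (intro card_mono finite_nlists finS) auto
  then have "real (card ?B) \<le> real (card S) ^ n"
    by (simp add: card_nlists finS flip: of_nat_power)
  then have B: "real (card ?B) * s \<le> real (card S) ^ n * s"
    using s by (rule mult_right_mono)
  have "card A \<le> card (S \<union> (\<Union>b\<in>?B. {a\<in>A. a # b \<notin> E}))"
    using finS finB fin by (intro card_mono sub) auto
  also have "\<dots> \<le> card S + (\<Sum>b\<in>?B. card {a\<in>A. a # b \<notin> E})"
    by (intro order.trans[OF card_Un_le] add_left_mono card_UN_le finB)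
  finally have "real (card A) \<le> real (card S + (\<Sum>b\<in>?B. card {a\<in>A. a # b \<notin> E}))"
    by (rule of_nat_mono)
  also have "\<dots> = real (card S) + (\<Sum>b\<in>?B. real (card {a\<in>A. a # b \<notin> E}))"
    by simp
  also have "\<dots> \<le> real (card S) + real (card ?B) * s"
    using sum_bounded_above[of ?B "\<lambda>b. real (card {a\<in>A. a # b \<notin> E})" s] small' by simp
  also have "\<dots> \<le> real (card S) + real (card S) ^ n * s"
    using B by simp
  finally show ?thesis using S(1) by auto
qed

definition homogeneous :: "nat \<Rightarrow> 'a list set \<Rightarrow> 'a set \<Rightarrow> bool" where
  "homogeneous n E A \<longleftrightarrow> all_tuples_in n E A \<or> all_tuples_in n (- E) A"

section \<open>Finite sets: induction on the arity\<close>

text \<open>Each of the \<open>m ^ 2\<close> pairs excludes only a small set of \<open>x\<close>, so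
  one \<open>x\<close> in \<open>A\<close> follows the majority for all pairs at once. Appending it
  to the parameters \<open>b j\<close> gives the half graph for \<open>E\<close>, with symmetry
  moving \<open>x\<close> past \<open>a i\<close>.\<close>

lemma half_graph_majority:
  fixes s :: real
  assumes sym: "symmetric_rel E" and fin: "finite A"
    and unsplit: "\<And>b. b \<in> nlists (Suc k) A \<Longrightarrow>
        card {a\<in>A. a # b \<in> E} < s \<or> card {a\<in>A. a # b \<notin> E} < s"
    and big: "real (m ^ 2) * s < card A"
    and half: "half_graph (\<lambda>a b. card {x\<in>A. x # a # b \<notin> E} < s) A (nlists k A) m"
  shows "half_graph (\<lambda>a b. a # b \<in> E) A (nlists (Suc k) A) m"
proof -
  obtain a b where ab: "\<And>i. i \<in> {1..m} \<Longrightarrow> a i \<in> A" "\<And>j. j \<in> {1..m} \<Longrightarrow> b j \<in> nlists k A"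
    and iff: "\<And>i j. i \<in> {1..m} \<Longrightarrow> j \<in> {1..m} \<Longrightarrow>
        real (card {x\<in>A. x # a i # b j \<notin> E}) < s \<longleftrightarrow> i < j"
    using half by (rule half_graphD) blast
  let ?I = "{1..m} \<times> {1..m}"
  \<comment> \<open>The minority side of the tuple \<open>a i # b j\<close>: \<open>iff\<close>
    tells which side is meant, and \<open>unsplit\<close> makes it small when \<open>i < j\<close>
    fails.\<close>
  define X where "X = (\<lambda>(i, j). {x\<in>A. (x # a i # b j \<in> E) \<noteq> (i < j)})"
  have "real (card (X p)) \<le> s" if pI: "p \<in> ?I" for p
  proof -
    obtain i j where p: "p = (i, j)" "i \<in> {1..m}" "j \<in> {1..m}" using pI by (cases p) auto
    have "a i # b j \<in> nlists (Suc k) A" using ab p by simp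
    from unsplit[OF this] iff[OF p(2,3)] show ?thesis
      unfolding X_def p by (cases "i < j") auto
  qed
  then have "(\<Sum>p\<in>?I. real (card (X p))) \<le> real (card ?I) * s"
    by (intro sum_bounded_above) auto
  moreover have "card (\<Union>p\<in>?I. X p) \<le> (\<Sum>p\<in>?I. card (X p))"
    by (intro card_UN_le) auto
  then have "real (card (\<Union>p\<in>?I. X p)) \<le> (\<Sum>p\<in>?I. real (card (X p)))"
    by (metis of_nat_le_iff of_nat_sum)
  ultimately have "card (\<Union>p\<in>?I. X p) < card A"
    using big by (simp add: power2_eq_square)
  moreover have "finite (\<Union>p\<in>?I. X p)" using fin unfolding X_def by auto
  ultimately have "\<not> A \<subseteq> (\<Union>p\<in>?I. X p)" by (meson card_mono not_le)
  then obtain x where x: "x \<in> A" "\<And>i j. i \<in> {1..m} \<Longrightarrow> j \<in> {1..m} \<Longrightarrow> x \<notin> X (i, j)"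
    by blast
  show ?thesis
  proof (rule half_graphI[of _ a _ "\<lambda>j. x # b j"])
    fix i j assume ij: "i \<in> {1..m}" "j \<in> {1..m}"
    have "a i # x # b j \<in> E \<longleftrightarrow> x # a i # b j \<in> E"
      by (rule symmetric_relD[OF sym]) simp
    then show "a i # x # b j \<in> E \<longleftrightarrow> i < j"
      using x(2)[OF ij] x(1) unfolding X_def by auto
  qed (use ab x(1) in auto)
qed

text \<open>\<open>T\<close>, \<open>N\<close> and \<open>S\<close> are the sizes of the unsplit
  set, of the homogeneous set for the majority relation and of the greedy set. The term
  \<open>S\<close> is absorbed into the product at the cost of a factor 2, which
  \<open>T powr (c / 4)\<close> exceeds by the lower bound on \<open>T\<close>; an
  \<open>n\<close>-th root remains.\<close>

lemma homogeneous_powr_bound: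
  fixes c S T N :: real and n :: nat
  assumes "0 < c" "0 < n" "1 \<le> S" "1 \<le> T" "2 powr (4 / c) \<le> T"
    and N: "T powr c \<le> N" "N \<le> S + S ^ n * T powr (c / 2)"
  shows "T powr (c / (4 * n)) \<le> S"
proof -
  have T2: "T powr (c / 2) \<ge> 1" using assms by (simp add: ge_one_powr_ge_zero)
  have "S ^ 1 \<le> S ^ n" using assms by (intro power_increasing) auto
  also have "S ^ n * 1 \<le> S ^ n * T powr (c / 2)" using T2 assms by (intro mult_left_mono) auto
  finally have "T powr c \<le> 2 * S ^ n * T powr (c / 2)" using N by simp
  then have "T powr (c / 2) * T powr (c / 2) \<le> 2 * S ^ n * T powr (c / 2)"
    by (simp flip: powr_add)
  then have *: "T powr (c / 2) \<le> 2 * S ^ n"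
    by (rule mult_right_le_imp_le) (use T2 in linarith)
  have "(2 powr (4 / c)) powr (c / 4) \<le> T powr (c / 4)"
    using assms by (intro powr_mono2) auto
  then have "2 \<le> T powr (c / 4)" using assms by (simp add: powr_powr)
  then have "2 * T powr (c / 4) \<le> T powr (c / 4) * T powr (c / 4)"
    by (intro mult_right_mono) auto
  also have "\<dots> = T powr (c / 2)" by (simp flip: powr_add)
  finally have "T powr (c / 4) \<le> S ^ n" using * by simp
  then have "(T powr (c / 4)) powr (1 / n) \<le> (S ^ n) powr (1 / n)"
    using assms by (intro powr_mono2) auto
  also have "(S ^ n) powr (1 / n) = S"
    using assms by (simp add: powr_powr flip: powr_realpow)
  finally show ?thesis by (simp add: powr_powr)
qed

text \<open>The constants are chosen before \<open>V\<close> and \<open>E\<close>, so that one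
  exponent serves almost all factors of the ultraproduct.\<close>

lemma finite_stable_homogeneous:
  assumes "n \<ge> 1"
  shows "\<exists>c K. 0 < c \<and> c \<le> 1 \<and> (\<forall>(V :: 'a set) E. finite V \<longrightarrow> symmetric_rel E \<longrightarrow>
    \<not> half_graph (\<lambda>a b. a # b \<in> E) V (nlists (n - 1) V) m \<longrightarrow> K \<le> real (card V) \<longrightarrow>
    (\<exists>A\<subseteq>V. real (card V) powr c \<le> card A \<and> homogeneous n E A))"
  using assms
proof (induction n rule: nat_induct_at_least)
  case base
  \<comment> \<open>The larger of the two sides has at least half the points, which is at least the
    square root once there are 4 points.\<close>
  have "\<exists>A\<subseteq>V. real (card V) powr (1/2) \<le> card A \<and> homogeneous 1 E A"
    if V: "finite V" "4 \<le> real (card V)" for V :: "'a set" and E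
  proof -
    let ?P = "{v\<in>V. [v] \<in> E}" and ?Q = "{v\<in>V. [v] \<notin> E}"
    have hom: "homogeneous 1 E ?P" "homogeneous 1 E ?Q"
      unfolding homogeneous_def all_tuples_in_def by (auto simp: nlists_Suc)
    have "card V = card (?P \<union> ?Q)" by (rule arg_cong[of _ _ card]) auto
    also have "\<dots> = card ?P + card ?Q" using V(1) by (intro card_Un_disjoint) auto
    finally have sum: "real (card V) = real (card ?P) + real (card ?Q)" by simp
    have "4 powr (1/2) \<le> real (card V) powr (1/2)" using V(2) by (intro powr_mono2) auto
    then have "2 \<le> real (card V) powr (1/2)" by (simp add: powr_half_sqrt)
    then have "2 * real (card V) powr (1/2) \<le> real (card V) powr (1/2) * real (card V) powr (1/2)"
      by (intro mult_right_mono) auto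
    also have "\<dots> = real (card V)" using V(2) by (simp flip: powr_add)
    finally have "real (card V) powr (1/2) \<le> card ?P \<or> real (card V) powr (1/2) \<le> card ?Q"
      using sum by linarith
    moreover have "?P \<subseteq> V" "?Q \<subseteq> V" by auto
    ultimately show ?thesis using hom by blast
  qed
  then show ?case by (intro exI[of _ "1/2"] exI[of _ 4]) auto
next
  case (Suc n)
  then obtain c K where c: "0 < c" "c \<le> 1"
    and IH: "\<And>(V :: 'a set) E. finite V \<Longrightarrow> symmetric_rel E \<Longrightarrow>
      \<not> half_graph (\<lambda>a b. a # b \<in> E) V (nlists (n - 1) V) m \<Longrightarrow> K \<le> real (card V) \<Longrightarrow>
      \<exists>A\<subseteq>V. real (card V) powr c \<le> card A \<and> homogeneous n E A"
    by blast
  define h where "h = ladder_depth (2 * m + 2)"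
  \<comment> \<open>Exceptional sets then have size below \<open>card A powr (c / 2)\<close>, well
    under the size \<open>card A powr c\<close> of the set given by the induction hypothesis.
    Moreover \<theta> is at most 1/2, so \<open>m ^ 2\<close> of them cannot cover a large
    \<open>A\<close>.\<close>
  define \<theta> where "\<theta> = c / 2"
  \<comment> \<open>A lower bound for \<open>card A\<close>: \<open>K\<close> serves the induction
    hypothesis, the square gives \<open>m ^ 2 < sqrt (card A)\<close>, and the last term serves
    \<open>homogeneous_powr_bound\<close>.\<close>
  define T where "T = max (max K ((real m ^ 2 + 3) ^ 2)) (2 powr (4 / c))"
  \<comment> \<open>The factor \<open>\<theta> ^ h\<close> is the loss from \<open>V\<close> to the
    unsplit set, \<open>c / (4 * n)\<close> the loss from there to the greedy set.\<close>
  define c' where "c' = \<theta> ^ h * (c / (4 * n))"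
  have \<theta>: "0 < \<theta>" "\<theta> \<le> 1 / 2" unfolding \<theta>_def using c by auto
  have n: "n \<ge> 1" using Suc by simp
  have T1: "T \<ge> 1" unfolding T_def by (simp add: le_max_iff_disj)
  have "0 < c'" unfolding c'_def using \<theta> c n by simp
  moreover have "c' \<le> 1"
    unfolding c'_def using \<theta> c n by (intro mult_le_one power_le_one) (auto simp: divide_le_eq)
  moreover have "\<exists>A\<subseteq>V. real (card V) powr c' \<le> card A \<and> homogeneous (Suc n) E A"
    if V: "finite V" "T powr (1 / \<theta> ^ h) \<le> card V" and sym: "symmetric_rel E"
      and nhg: "\<not> half_graph (\<lambda>a b. a # b \<in> E) V (nlists n V) m" for V :: "'a set" and E
  proof -
    have "V \<noteq> {}" using V(2) T1 by auto
    moreover have "\<not> splits (\<lambda>a b. a # b \<in> E) (nlists n V) h V"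
      using splits_half_graph nhg unfolding h_def by blast
    ultimately obtain A where A: "A \<subseteq> V" "card A \<ge> real (card V) powr (\<theta> ^ h)"
      and unsplit: "\<And>b. b \<in> nlists n V \<Longrightarrow>
           card {a\<in>A. a # b \<in> E} < real (card A) powr \<theta> \<or>
           card {a\<in>A. a # b \<notin> E} < real (card A) powr \<theta>"
      using exists_unsplit_subset[of \<theta> V "\<lambda>a b. a # b \<in> E" "nlists n V" h] V(1) \<theta> by auto
    have finA: "finite A" using A(1) V(1) finite_subset by blast
    have "(T powr (1 / \<theta> ^ h)) powr (\<theta> ^ h) \<le> real (card V) powr (\<theta> ^ h)"
      using V(2) \<theta> by (intro powr_mono2) auto
    then have T: "T \<le> card A" using A(2) \<theta> T1 by (simp add: powr_powr)
    then have A1: "1 \<le> real (card A)" using T1 by linarith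
    define s where "s = real (card A) powr \<theta>"
    \<comment> \<open>The majority relation. It is defined on lists of every length but only tested
      on \<open>n\<close>-tuples.\<close>
    define F where "F = {b. card {a\<in>A. a # b \<notin> E} < s}"
    have "(real m ^ 2 + 3) ^ 2 \<le> real (card A)" using T unfolding T_def by simp
    then have "((real m ^ 2 + 3) ^ 2) powr (1/2) \<le> real (card A) powr (1/2)"
      by (intro powr_mono2) auto
    then have "real m ^ 2 + 3 \<le> real (card A) powr (1/2)"
      by (simp add: powr_half_sqrt)
    then have "real m ^ 2 < real (card A) powr (1/2)" by simp
    moreover have "s \<le> real (card A) powr (1/2)"
      unfolding s_def using A1 \<theta> by (intro powr_mono) auto
    moreover have "s > 0" unfolding s_def using A1 by simp
    ultimately have "real m ^ 2 * s < real (card A) powr (1/2) * real (card A) powr (1/2)"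
      by (intro mult_less_le_imp_less) auto
    also have "\<dots> = card A" using A1 by (simp flip: powr_add)
    finally have big: "real (m ^ 2) * s < card A" by simp
    obtain k where k: "n = Suc k" using n by (cases n) auto
    have "\<not> half_graph (\<lambda>a b. a # b \<in> F) A (nlists (n - 1) A) m"
    proof
      assume "half_graph (\<lambda>a b. a # b \<in> F) A (nlists (n - 1) A) m"
      then have "half_graph (\<lambda>a b. card {x\<in>A. x # a # b \<notin> E} < s) A (nlists k A) m"
        unfolding F_def k by simp
      moreover have "card {a\<in>A. a # b \<in> E} < s \<or> card {a\<in>A. a # b \<notin> E} < s"
        if "b \<in> nlists (Suc k) A" for b
        using unsplit[of b] that nlists_mono[OF A(1)] unfolding k s_def by blast
      ultimately have "half_graph (\<lambda>a b. a # b \<in> E) A (nlists n A) m"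
        using half_graph_majority[OF sym finA _ big] unfolding k by blast
      then show False using nhg half_graph_mono A(1) nlists_mono[OF A(1)] by blast
    qed
    moreover have "symmetric_rel F"
      unfolding symmetric_rel_def
    proof (intro allI impI)
      fix xs ys :: "'a list" assume m: "mset xs = mset ys" "xs \<in> F"
      have "a # xs \<in> E \<longleftrightarrow> a # ys \<in> E" for a
        by (rule symmetric_relD[OF sym]) (simp add: m(1))
      then show "ys \<in> F" using m(2) unfolding F_def by simp
    qed
    moreover have "K \<le> card A" using T unfolding T_def by simp
    ultimately obtain B where B: "B \<subseteq> A" "real (card A) powr c \<le> card B" "homogeneous n F B"
      using IH[OF finA] by blast
    have finB: "finite B" using B(1) finA finite_subset by blast
    have "0 < real (card B)" using B(2) A1 by (smt (verit) powr_gt_zero)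
    then have neB: "B \<noteq> {}" by auto
    have mono: "real (card {a\<in>B. P a}) \<le> real (card {a\<in>A. P a})" for P
      using B(1) finA by (intro of_nat_mono card_mono) auto
    \<comment> \<open>\<open>G\<close> is the side that the majority takes on all distinct tuples of
      \<open>B\<close>. Outside \<open>F\<close>, \<open>unsplit\<close> makes the set of extensions
      in \<open>E\<close> small.\<close>
    have "\<exists>G. (G = E \<or> G = - E) \<and>
      (\<forall>b\<in>nlists n B. distinct b \<longrightarrow> real (card {a\<in>B. a # b \<notin> G}) \<le> s)"
    proof (cases "all_tuples_in n F B")
      case True
      have "real (card {a\<in>B. a # b \<notin> E}) \<le> s" if b: "b \<in> nlists n B" "distinct b" for b
      proof -
        have "real (card {a\<in>A. a # b \<notin> E}) < s"
          using True b unfolding all_tuples_in_def F_def by simp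
        with mono[of "\<lambda>a. a # b \<notin> E"] show ?thesis by linarith
      qed
      then show ?thesis by blast
    next
      case False
      then have F: "b \<notin> F" if "b \<in> nlists n B" "distinct b" for b
        using B(3) that unfolding homogeneous_def all_tuples_in_def by blast
      have "real (card {a\<in>B. a # b \<notin> - E}) \<le> s" if b: "b \<in> nlists n B" "distinct b" for b
      proof -
        have "b \<in> nlists n V" using b(1) nlists_mono[of B V n] A(1) B(1) by blast
        from unsplit[OF this] F[OF b] have "real (card {a\<in>A. a # b \<in> E}) < s"
          unfolding F_def s_def by simp
        with mono[of "\<lambda>a. a # b \<in> E"] show ?thesis by simp
      qed
      then show ?thesis by (intro exI[of _ "- E"]) blast
    qed
    then obtain G where G: "G = E \<or> G = - E"
      "\<And>b. b \<in> nlists n B \<Longrightarrow> distinct b \<Longrightarrow> real (card {a\<in>B. a # b \<notin> G}) \<le> s"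
      by blast
    have symG: "symmetric_rel G" using G(1) sym symmetric_rel_Compl by blast
    obtain S where S: "S \<subseteq> B" "all_tuples_in (Suc n) G S" "S \<noteq> {}"
      "card B \<le> card S + real (card S) ^ n * s"
      using greedy_all_tuples_in[OF n finB neB symG _ G(2)] \<open>s > 0\<close> by auto
    have finS: "finite S" using S(1) finB finite_subset by blast
    have "1 \<le> real (card S)" using S(3) finS by (simp add: Suc_leI card_gt_0_iff)
    then have "real (card A) powr (c / (4 * n)) \<le> card S"
      using S(4) B(2) A1 T c n unfolding s_def \<theta>_def T_def
      by (intro homogeneous_powr_bound[where N = "card B"]) auto
    moreover have "(real (card V) powr (\<theta> ^ h)) powr (c / (4 * n)) \<le> card A powr (c / (4 * n))"
      using A(2) c by (intro powr_mono2) auto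
    ultimately have "real (card V) powr c' \<le> card S"
      unfolding c'_def by (simp add: powr_powr)
    moreover have "homogeneous (Suc n) E S"
      using G(1) S(2) unfolding homogeneous_def by auto
    ultimately show ?thesis using S(1) B(1) A(1) by blast
  qed
  ultimately show ?case
    by (intro exI[of _ c'] exI[of _ "T powr (1 / \<theta> ^ h)"]) auto
qed

section \<open>Transfer between the factors and the ultraproduct\<close>

lemma ultrafilter_not_eventually:
  "ultrafilter F \<Longrightarrow> \<not> eventually P F \<Longrightarrow> eventually (\<lambda>i. \<not> P i) F"
  unfolding ultrafilter_def by blast

lemma ultrafilter_eventually_bex:
  assumes F: "ultrafilter F" and fin: "finite S" and ev: "eventually (\<lambda>i. \<exists>x\<in>S. P x i) F"
  shows "\<exists>x\<in>S. eventually (P x) F"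
proof (rule ccontr)
  assume "\<not> ?thesis"
  then have "\<forall>x\<in>S. eventually (\<lambda>i. \<not> P x i) F"
    using ultrafilter_not_eventually[OF F] by blast
  then have "eventually (\<lambda>i. \<forall>x\<in>S. \<not> P x i) F"
    using fin by (simp add: eventually_ball_finite_distrib)
  with ev have "eventually (\<lambda>i. False) F" by (rule eventually_elim2) blast
  then show False using F by (simp add: ultrafilter_def)
qed

lemma ae_eq_class_eq_iff:
  "ae_eq F `` {f} = ae_eq F `` {g} \<longleftrightarrow> eventually (\<lambda>i. f i = g i) F"
  using eq_equiv_class_iff[OF equiv_ae_eq, of f g F] by (simp add: ae_eq_def)

lemma ultraproductE:
  assumes "x \<in> ultraproduct F A"
  obtains f where "x = ae_eq F `` {f}" "eventually (\<lambda>i. f i \<in> A i) F"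
  using assms unfolding ultraproduct_def quotient_def by blast

text \<open>Membership does not depend on the representatives: a tuple has finitely many
  coordinates, and two choices agree almost everywhere on all of them at once.\<close>

lemma class_tuple_in_iff:
  assumes "length fs = n"
  shows "map (\<lambda>f. ae_eq F `` {f}) fs \<in> ultraproduct_tuples F n B \<longleftrightarrow>
         eventually (\<lambda>i. map (\<lambda>f. f i) fs \<in> B i) F"
proof
  assume "map (\<lambda>f. ae_eq F `` {f}) fs \<in> ultraproduct_tuples F n B"
  then obtain gs where gs: "map (\<lambda>f. ae_eq F `` {f}) fs = map (\<lambda>f. ae_eq F `` {f}) gs"
      "eventually (\<lambda>i. map (\<lambda>f. f i) gs \<in> B i) F"
    unfolding ultraproduct_tuples_def by auto
  have len: "length gs = length fs"
    using map_eq_imp_length_eq[OF gs(1)] by simp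
  have "eventually (\<lambda>i. (fs ! k) i = (gs ! k) i) F" if k: "k < length fs" for k
    using arg_cong[OF gs(1), of "\<lambda>xs. xs ! k"] k len by (simp add: ae_eq_class_eq_iff)
  then have "eventually (\<lambda>i. \<forall>k\<in>{..<length fs}. (fs ! k) i = (gs ! k) i) F"
    by (simp add: eventually_ball_finite_distrib)
  with gs(2) show "eventually (\<lambda>i. map (\<lambda>f. f i) fs \<in> B i) F"
  proof (rule eventually_elim2)
    fix i assume *: "map (\<lambda>f. f i) gs \<in> B i" "\<forall>k\<in>{..<length fs}. (fs ! k) i = (gs ! k) i"
    have "map (\<lambda>f. f i) fs = map (\<lambda>f. f i) gs"
      using *(2) len by (auto simp: list_eq_iff_nth_eq)
    then show "map (\<lambda>f. f i) fs \<in> B i" using *(1) by simp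
  qed
next
  assume "eventually (\<lambda>i. map (\<lambda>f. f i) fs \<in> B i) F"
  then show "map (\<lambda>f. ae_eq F `` {f}) fs \<in> ultraproduct_tuples F n B"
    unfolding ultraproduct_tuples_def using assms by blast
qed

lemma nlists_ultraproductE:
  assumes "as \<in> nlists n (ultraproduct F A)"
  obtains fs where "as = map (\<lambda>f. ae_eq F `` {f}) fs" "length fs = n"
    "\<And>f. f \<in> set fs \<Longrightarrow> eventually (\<lambda>i. f i \<in> A i) F"
proof -
  have "\<forall>x\<in>set as. \<exists>f. x = ae_eq F `` {f} \<and> eventually (\<lambda>i. f i \<in> A i) F"
    using assms ultraproductE[of _ F A] unfolding nlists_def by blast
  then obtain r where r: "\<And>x. x \<in> set as \<Longrightarrow> x = ae_eq F `` {r x}"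
      "\<And>x. x \<in> set as \<Longrightarrow> eventually (\<lambda>i. r x i \<in> A i) F"
    by metis
  show thesis
  proof (rule that[of "map r as"])
    show "as = map (\<lambda>f. ae_eq F `` {f}) (map r as)"
      using r(1) by (simp add: map_idI)
  qed (use assms r(2) in \<open>auto simp: nlistsE_length\<close>)
qed

text \<open>Turns a family of tuples into the tuple of its coordinate classes. Entries
  \<open>xs i ! k\<close> beyond the length are unspecified, so membership is characterised for
  families of length \<open>n\<close> almost everywhere.\<close>

definition tuple_class :: "'i filter \<Rightarrow> nat \<Rightarrow> ('i \<Rightarrow> 'a list) \<Rightarrow> ('i \<Rightarrow> 'a) set list" where
  "tuple_class F n xs = map (\<lambda>k. ae_eq F `` {\<lambda>i. xs i ! k}) [0..<n]"

lemma tuple_class_in_iff: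
  assumes "eventually (\<lambda>i. length (xs i) = n) F"
  shows "tuple_class F n xs \<in> ultraproduct_tuples F n B \<longleftrightarrow> eventually (\<lambda>i. xs i \<in> B i) F"
proof -
  let ?fs = "map (\<lambda>k i. xs i ! k) [0..<n]"
  have "tuple_class F n xs = map (\<lambda>f. ae_eq F `` {f}) ?fs"
    unfolding tuple_class_def by simp
  then have "tuple_class F n xs \<in> ultraproduct_tuples F n B \<longleftrightarrow>
      eventually (\<lambda>i. map (\<lambda>f. f i) ?fs \<in> B i) F"
    using class_tuple_in_iff[of ?fs n F B] by simp
  also have "eventually (\<lambda>i. map (\<lambda>f. f i) ?fs = xs i) F"
    using assms by eventually_elim (auto simp: list_eq_iff_nth_eq)
  then have "eventually (\<lambda>i. map (\<lambda>f. f i) ?fs \<in> B i) F \<longleftrightarrow> eventually (\<lambda>i. xs i \<in> B i) F"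
    by (rule eventually_cong) simp
  finally show ?thesis .
qed

lemma tuple_class_in_nlists:
  assumes "eventually (\<lambda>i. xs i \<in> nlists n (V i)) F"
  shows "tuple_class F n xs \<in> nlists n (ultraproduct F V)"
proof -
  have "ae_eq F `` {\<lambda>i. xs i ! k} \<in> ultraproduct F V" if "k < n" for k
    unfolding class_in_ultraproduct_iff
    using assms by eventually_elim (use that in \<open>auto intro: nlistsE_nth_in\<close>)
  then show ?thesis unfolding tuple_class_def nlists_def by auto
qed

lemma tuple_class_Cons:
  "tuple_class F (Suc n) (\<lambda>i. a i # b i) = (ae_eq F `` {a}) # tuple_class F n b"
  unfolding tuple_class_def by (simp add: upt_conv_Cons map_Suc_upt[symmetric] del: upt_Suc)

text \<open>If a fixed permutation failed in almost all factors, the class of a choice of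
  counterexamples would violate symmetry of the ultraproduct. As there are finitely many
  permutations, almost every factor is closed under all of them.\<close>

lemma eventually_symmetric_rel:
  assumes F: "ultrafilter F" and B: "\<And>i. B i \<subseteq> nlists n (V i)"
    and sym: "symmetric_tuples (ultraproduct_tuples F n B)"
  shows "eventually (\<lambda>i. symmetric_rel (B i)) F"
proof -
  have "eventually (\<lambda>i. \<forall>xs\<in>B i. permute_list \<sigma> xs \<in> B i) F" if \<sigma>: "\<sigma> permutes {..<n}" for \<sigma>
  proof (rule ccontr)
    assume "\<not> ?thesis"
    from ultrafilter_not_eventually[OF F this]
    have ev: "eventually (\<lambda>i. \<exists>xs. xs \<in> B i \<and> permute_list \<sigma> xs \<notin> B i) F"
      by (rule eventually_mono) auto
    define xs where "xs i = (SOME xs. xs \<in> B i \<and> permute_list \<sigma> xs \<notin> B i)" for i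
    have xs: "eventually (\<lambda>i. xs i \<in> B i \<and> permute_list \<sigma> (xs i) \<notin> B i) F"
      using ev unfolding xs_def by eventually_elim (rule someI_ex)
    then have mem: "eventually (\<lambda>i. xs i \<in> B i) F"
      and nmem: "eventually (\<lambda>i. permute_list \<sigma> (xs i) \<notin> B i) F"
      by (auto elim: eventually_mono)
    have len: "eventually (\<lambda>i. length (xs i) = n) F"
      using mem by eventually_elim (use B nlistsE_length in blast)
    have "tuple_class F n xs \<in> ultraproduct_tuples F n B"
      using tuple_class_in_iff[OF len] mem by blast
    moreover have "length (tuple_class F n xs) = n" by (simp add: tuple_class_def)
    ultimately have 1: "permute_list \<sigma> (tuple_class F n xs) \<in> ultraproduct_tuples F n B"
      using sym \<sigma> unfolding symmetric_tuples_def by force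
    have "ae_eq F `` {\<lambda>i. xs i ! \<sigma> k} = ae_eq F `` {\<lambda>i. permute_list \<sigma> (xs i) ! k}" if "k < n" for k
      unfolding ae_eq_class_eq_iff
      using len by eventually_elim (use \<sigma> that in \<open>simp add: permute_list_nth\<close>)
    moreover have "\<sigma> k < n" if "k < n" for k
      using permutes_in_image[OF \<sigma>, of k] that by simp
    ultimately have "permute_list \<sigma> (tuple_class F n xs) = tuple_class F n (\<lambda>i. permute_list \<sigma> (xs i))"
      using \<sigma> by (auto simp: list_eq_iff_nth_eq tuple_class_def permute_list_nth)
    then have "eventually (\<lambda>i. permute_list \<sigma> (xs i) \<in> B i) F"
      using 1 len tuple_class_in_iff[of "\<lambda>i. permute_list \<sigma> (xs i)" n F B] by simp
    with nmem have "eventually (\<lambda>i. False) F" by (rule eventually_elim2) blast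
    then show False using F by (simp add: ultrafilter_def)
  qed
  then have "eventually (\<lambda>i. \<forall>\<sigma>\<in>{\<sigma>. \<sigma> permutes {..<n}}. \<forall>xs\<in>B i. permute_list \<sigma> xs \<in> B i) F"
    by (intro eventually_ball_finite finite_permutations) auto
  then show ?thesis
  proof eventually_elim
    fix i assume *: "\<forall>\<sigma>\<in>{\<sigma>. \<sigma> permutes {..<n}}. \<forall>xs\<in>B i. permute_list \<sigma> xs \<in> B i"
    show "symmetric_rel (B i)"
      unfolding symmetric_rel_def
    proof (intro allI impI)
      fix xs ys :: "'b list" assume m: "mset xs = mset ys" "xs \<in> B i"
      have "length xs = n" using m(2) B nlistsE_length by blast
      moreover obtain \<sigma> where "\<sigma> permutes {..<length xs}" "permute_list \<sigma> xs = ys"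
        using mset_eq_permutation[of ys xs] m(1) by metis
      ultimately show "ys \<in> B i" using * m(2) by auto
    qed
  qed
qed

text \<open>The classes of half graphs chosen in the factors form a half graph in the ultraproduct.
  By contraposition, stability passes to almost all factors with the same \<open>m\<close>.\<close>

lemma half_graph_ultraproduct:
  assumes F: "ultrafilter F" and B: "\<And>i. B i \<subseteq> nlists (Suc n) (V i)"
    and ev: "eventually (\<lambda>i. half_graph (\<lambda>a b. a # b \<in> B i) (V i) (nlists n (V i)) m) F"
  shows "half_graph (\<lambda>a b. a # b \<in> ultraproduct_tuples F (Suc n) B)
    (ultraproduct F V) (nlists n (ultraproduct F V)) m"
proof -
  let ?P = "\<lambda>i (a :: nat \<Rightarrow> 'b) (b :: nat \<Rightarrow> 'b list). (\<forall>p\<in>{1..m}. a p \<in> V i) \<and>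
      (\<forall>q\<in>{1..m}. b q \<in> nlists n (V i)) \<and>
      (\<forall>p\<in>{1..m}. \<forall>q\<in>{1..m}. a p # b q \<in> B i \<longleftrightarrow> p < q)"
  \<comment> \<open>The implication allows arbitrary values at indices without a half graph, so the
    choice is total.\<close>
  have "\<exists>a b. half_graph (\<lambda>a b. a # b \<in> B i) (V i) (nlists n (V i)) m \<longrightarrow> ?P i a b" for i
  proof (cases "half_graph (\<lambda>a b. a # b \<in> B i) (V i) (nlists n (V i)) m")
    case True
    then have "\<exists>a b. ?P i a b" unfolding half_graph_def .
    then show ?thesis by (elim exE) (intro exI impI)
  qed simp
  then obtain a b where
    "\<And>i. half_graph (\<lambda>a b. a # b \<in> B i) (V i) (nlists n (V i)) m \<Longrightarrow> ?P i (a i) (b i)"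
    by metis
  with ev have ab: "eventually (\<lambda>i. ?P i (a i) (b i)) F" by (rule eventually_mono)
  have evV: "eventually (\<lambda>i. a i p \<in> V i) F" if "p \<in> {1..m}" for p
    using ab by eventually_elim (use that in blast)
  have evN: "eventually (\<lambda>i. b i q \<in> nlists n (V i)) F" if "q \<in> {1..m}" for q
    using ab by eventually_elim (use that in blast)
  show ?thesis
  proof (rule half_graphI[of _ "\<lambda>p. ae_eq F `` {\<lambda>i. a i p}" _ "\<lambda>q. tuple_class F n (\<lambda>i. b i q)"])
    fix p q assume pq: "p \<in> {1..m}" "q \<in> {1..m}"
    have len: "eventually (\<lambda>i. length (a i p # b i q) = Suc n) F"
      using evN[OF pq(2)] by eventually_elim (simp add: nlistsE_length)
    have "eventually (\<lambda>i. a i p # b i q \<in> B i \<longleftrightarrow> p < q) F"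
      using ab by eventually_elim (use pq in blast)
    then have "eventually (\<lambda>i. a i p # b i q \<in> B i) F \<longleftrightarrow> eventually (\<lambda>i. p < q) F"
      by (rule eventually_cong)
    \<comment> \<open>The condition is independent of \<open>i\<close>, and the filter is
      proper.\<close>
    also have "\<dots> \<longleftrightarrow> p < q" using F by (auto simp: ultrafilter_def)
    finally show "(ae_eq F `` {\<lambda>i. a i p}) # tuple_class F n (\<lambda>i. b i q)
        \<in> ultraproduct_tuples F (Suc n) B \<longleftrightarrow> p < q"
      unfolding tuple_class_Cons[symmetric] tuple_class_in_iff[OF len] .
  qed (use evV evN in \<open>auto simp: class_in_ultraproduct_iff intro!: tuple_class_in_nlists\<close>)
qed

text \<open>Otherwise almost all factors are enumerated by numbers below \<open>K\<close>. The
  ultrafilter then makes each element agree almost everywhere with one of these \<open>K\<close>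
  enumerating functions, so the ultraproduct would be finite.\<close>

lemma eventually_card_ge:
  fixes V :: "'i \<Rightarrow> 'a set"
  assumes F: "ultrafilter F" and fin: "\<And>i. finite (V i)" and inf: "infinite (ultraproduct F V)"
  shows "eventually (\<lambda>i. K \<le> card (V i)) F"
proof (rule ccontr)
  assume "\<not> ?thesis"
  from ultrafilter_not_eventually[OF F this]
  have small: "eventually (\<lambda>i. card (V i) < K) F"
    by (rule eventually_mono) simp
  have "\<exists>e. \<forall>v\<in>V i. \<exists>k<card (V i). v = e k" for i
  proof -
    obtain h where "bij_betw h {0..<card (V i)} (V i)"
      using ex_bij_betw_nat_finite[OF fin[of i]] by blast
    then have im: "h ` {0..<card (V i)} = V i" by (simp add: bij_betw_def)
    show ?thesis
    proof (intro exI[of _ h] ballI)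
      fix v assume "v \<in> V i"
      then have "v \<in> h ` {0..<card (V i)}" unfolding im .
      then show "\<exists>k<card (V i). v = h k" by auto
    qed
  qed
  then obtain e where e: "\<And>i v. v \<in> V i \<Longrightarrow> \<exists>k<card (V i). v = e i k" by metis
  have "ultraproduct F V \<subseteq> (\<lambda>k. ae_eq F `` {\<lambda>i. e i k}) ` {..<K}"
  proof
    fix x assume "x \<in> ultraproduct F V"
    then obtain f where f: "x = ae_eq F `` {f}" "eventually (\<lambda>i. f i \<in> V i) F"
      by (rule ultraproductE)
    from f(2) small have "eventually (\<lambda>i. \<exists>k\<in>{..<K}. f i = e i k) F"
    proof (rule eventually_elim2)
      fix i assume i: "f i \<in> V i" "card (V i) < K"
      from e[OF i(1)] obtain k where "k < card (V i)" "f i = e i k" by blast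
      then show "\<exists>k\<in>{..<K}. f i = e i k" using i(2) by (intro bexI[of _ k]) auto
    qed
    from ultrafilter_eventually_bex[OF F _ this]
    obtain k where "k < K" "eventually (\<lambda>i. f i = e i k) F" by auto
    then show "x \<in> (\<lambda>k. ae_eq F `` {\<lambda>i. e i k}) ` {..<K}"
      using f(1) ae_eq_class_eq_iff[of F f] by blast
  qed
  then show False using inf finite_surj[of "{..<K}"] by blast
qed

text \<open>The logarithmic ratios lie in \<open>{c..1}\<close> almost everywhere, and compactness
  of this interval keeps their limit there.\<close>

lemma udim_ge:
  assumes V: "pseudo_finite F V" and A: "\<And>i. A i \<subseteq> V i" and c: "0 < c"
    and big: "eventually (\<lambda>i. real (card (V i)) powr c \<le> card (A i)) F"
  shows "udim F V (ultraproduct F A) \<ge> ereal c"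
proof -
  have F: "ultrafilter F" and fin: "finite (V i)" and inf: "infinite (ultraproduct F V)" for i
    using V by (auto simp: pseudo_finite_def)
  \<comment> \<open>Two elements make the denominator \<open>ln (card (V i))\<close>
    positive.\<close>
  have two: "eventually (\<lambda>i. 2 \<le> card (V i)) F" by (rule eventually_card_ge[OF F fin inf])
  let ?r = "\<lambda>i. ln (real (card (A i))) / ln (real (card (V i)))"
  have "eventually (\<lambda>i. A i \<noteq> {} \<and> ?r i \<in> {c..1}) F"
    using two big
  proof eventually_elim
    fix i assume i: "2 \<le> card (V i)" "real (card (V i)) powr c \<le> card (A i)"
    have "0 < real (card (V i)) powr c" using i(1) by simp
    then have A0: "0 < card (A i)" using i(2) by (metis not_le of_nat_0_less_iff less_le_trans)
    have "ln (real (card (V i)) powr c) \<le> ln (real (card (A i)))"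
      using i A0 by (subst ln_le_cancel_iff) auto
    then have "c * ln (real (card (V i))) \<le> ln (real (card (A i)))"
      using i(1) by (simp add: ln_powr)
    moreover have "card (A i) \<le> card (V i)" using A fin by (simp add: card_mono)
    then have "ln (real (card (A i))) \<le> ln (real (card (V i)))"
      using A0 by (simp add: ln_le_cancel_iff)
    moreover have "ln (real (card (V i))) > 0" using i(1) by simp
    ultimately show "A i \<noteq> {} \<and> ?r i \<in> {c..1}"
      using A0 by (auto simp: field_simps)
  qed
  then have ne: "eventually (\<lambda>i. A i \<noteq> {}) F" and r: "eventually (\<lambda>i. ?r i \<in> {c..1}) F"
    by (auto elim: eventually_mono)
  obtain l where l: "l \<in> {c..1}" "(?r \<longlongrightarrow> l) F"
    by (rule ultrafilter_tendsto_compact[OF F compact_Icc r])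
  have "eventually (\<lambda>i. (SOME x. x \<in> A i) \<in> A i) F"
    using ne by eventually_elim (simp add: some_in_eq)
  then have "ultraproduct F A \<noteq> {}"
    using class_in_ultraproduct_iff[of F "\<lambda>i. SOME x. x \<in> A i" A] by blast
  moreover have "udim_rel F V (ultraproduct F A) l"
    unfolding udim_rel_def using l c A by auto
  moreover have "definable F V (ultraproduct F A)" unfolding definable_def using A by blast
  ultimately have "udim F V (ultraproduct F A) = ereal l" using udim_eq[OF V] by blast
  then show ?thesis using l(1) by simp
qed

text \<open>Different classes only say that the representatives are not almost everywhere equal; the
  ultrafilter improves this to almost everywhere different, for finitely many pairs
  together.\<close>

lemma distinct_class_tuple:
  assumes F: "ultrafilter F" and dist: "distinct (map (\<lambda>f. ae_eq F `` {f}) fs)"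
  shows "eventually (\<lambda>i. distinct (map (\<lambda>f. f i) fs)) F"
proof -
  have "eventually (\<lambda>i. f i \<noteq> g i) F" if "f \<in> set fs" "g \<in> set fs - {f}" for f g
  proof (rule ultrafilter_not_eventually[OF F])
    show "\<not> eventually (\<lambda>i. f i = g i) F"
      using that dist inj_onD[of "\<lambda>f. ae_eq F `` {f}" "set fs" f g]
      by (auto simp: distinct_map ae_eq_class_eq_iff[symmetric])
  qed
  then have "eventually (\<lambda>i. \<forall>f\<in>set fs. \<forall>g\<in>set fs - {f}. f i \<noteq> g i) F"
    by (simp add: eventually_ball_finite_distrib)
  then show ?thesis
    by eventually_elim (use dist in \<open>auto simp: distinct_map inj_on_def\<close>)
qed

text \<open>The family \<open>G\<close> is left open so that both alternatives, \<open>B i\<close>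
  and its complement, can be transferred.\<close>

lemma eventually_all_tuples_inD:
  assumes F: "ultrafilter F"
    and ev: "eventually (\<lambda>i. all_tuples_in n (G i) (A i)) F"
    and as: "as \<in> nlists n (ultraproduct F A)" "distinct as"
  obtains fs where "as = map (\<lambda>f. ae_eq F `` {f}) fs" "length fs = n"
    "eventually (\<lambda>i. map (\<lambda>f. f i) fs \<in> G i) F"
proof -
  obtain fs where fs: "as = map (\<lambda>f. ae_eq F `` {f}) fs" "length fs = n"
    "\<And>f. f \<in> set fs \<Longrightarrow> eventually (\<lambda>i. f i \<in> A i) F"
    using as(1) by (rule nlists_ultraproductE) blast
  have 1: "eventually (\<lambda>i. \<forall>f\<in>set fs. f i \<in> A i) F"
    using fs(3) by (simp add: eventually_ball_finite_distrib)
  have 2: "eventually (\<lambda>i. distinct (map (\<lambda>f. f i) fs)) F"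
    using distinct_class_tuple[OF F] as(2) fs(1) by blast
  have "eventually (\<lambda>i. map (\<lambda>f. f i) fs \<in> G i) F"
    using ev 1 2
  proof eventually_elim
    fix i assume i: "all_tuples_in n (G i) (A i)" "\<forall>f\<in>set fs. f i \<in> A i"
      "distinct (map (\<lambda>f. f i) fs)"
    have "map (\<lambda>f. f i) fs \<in> nlists n (A i)"
      using i(2) fs(2) by (auto simp: nlists_def)
    with i(1,3) show "map (\<lambda>f. f i) fs \<in> G i" unfolding all_tuples_in_def by blast
  qed
  with fs that show thesis by blast
qed

section \<open>The definable homogeneous set\<close>

theorem proposition3p1:
  fixes F :: "'i filter"
    and V :: "'i \<Rightarrow> 'a set"
    and n :: nat
    and E :: "('i \<Rightarrow> 'a) set list set"
  assumes "n \<ge> 2"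
    and "pseudo_finite F V"
    and "definable_tuples F V n E"
    and "symmetric_tuples E"
    and "stable_partitioned (ultraproduct F V) n E"
  shows "\<exists>A. definable F V A \<and> udim F V A > 0 \<and>
           ((\<forall>as\<in>nlists n A. distinct as \<longrightarrow> as \<in> E) \<or>
            (\<forall>as\<in>nlists n A. distinct as \<longrightarrow> as \<notin> E))"
proof -
  have F: "ultrafilter F" and fin: "finite (V i)" and inf: "infinite (ultraproduct F V)" for i
    using assms(2) by (auto simp: pseudo_finite_def)
  obtain B where B: "\<And>i. B i \<subseteq> nlists n (V i)" "E = ultraproduct_tuples F n B"
    using assms(3) unfolding definable_tuples_def by blast
  obtain m where m: "\<not> half_graph (\<lambda>a b. a # b \<in> E) (ultraproduct F V)
      (nlists (n - 1) (ultraproduct F V)) m"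
    using assms(5) unfolding stable_partitioned_def half_graph_def by blast
  have n: "n = Suc (n - 1)" "n \<ge> 1" using assms(1) by auto
  have sym: "eventually (\<lambda>i. symmetric_rel (B i)) F"
    using assms(4) B by (intro eventually_symmetric_rel[OF F]) simp_all
  have stable: "eventually (\<lambda>i. \<not> half_graph (\<lambda>a b. a # b \<in> B i) (V i) (nlists (n - 1) (V i)) m) F"
    using half_graph_ultraproduct[OF F, of B "n - 1" V m] B m n(1)
    by (intro ultrafilter_not_eventually[OF F]) auto
  obtain c K where c: "0 < c"
    and hom: "\<And>(W :: 'a set) G. finite W \<Longrightarrow> symmetric_rel G \<Longrightarrow>
      \<not> half_graph (\<lambda>a b. a # b \<in> G) W (nlists (n - 1) W) m \<Longrightarrow> K \<le> real (card W) \<Longrightarrow>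
      \<exists>A\<subseteq>W. real (card W) powr c \<le> card A \<and> homogeneous n G A"
    using finite_stable_homogeneous[OF n(2), of m, where 'a = 'a] by blast
  have "eventually (\<lambda>i. nat \<lceil>K\<rceil> \<le> card (V i)) F"
    by (rule eventually_card_ge[OF F fin inf])
  then have big: "eventually (\<lambda>i. K \<le> card (V i)) F"
    by eventually_elim linarith
  let ?P = "\<lambda>i A. real (card (V i)) powr c \<le> card A \<and> homogeneous n (B i) A"
  \<comment> \<open>At the negligible indices without a good set, any subset of \<open>V i\<close>
    serves, so that \<open>A\<close> is internal.\<close>
  have "\<forall>i. \<exists>A\<subseteq>V i. (\<exists>A\<subseteq>V i. ?P i A) \<longrightarrow> ?P i A" by blast
  then obtain A where A: "\<And>i. A i \<subseteq> V i" "\<And>i. (\<exists>A\<subseteq>V i. ?P i A) \<Longrightarrow> ?P i (A i)"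
    by metis
  have P: "eventually (\<lambda>i. ?P i (A i)) F"
    using sym stable big by eventually_elim (rule A(2), rule hom, use fin in auto)
  have "eventually (\<lambda>i. real (card (V i)) powr c \<le> card (A i)) F"
    using P by (rule eventually_mono) simp
  then have "udim F V (ultraproduct F A) \<ge> ereal c"
    by (rule udim_ge[OF assms(2) A(1) c])
  moreover have "ereal c > 0" using c by simp
  ultimately have "udim F V (ultraproduct F A) > 0" by (rule less_le_trans[rotated])
  moreover have "definable F V (ultraproduct F A)" unfolding definable_def using A(1) by blast
  moreover have "(\<forall>as\<in>nlists n (ultraproduct F A). distinct as \<longrightarrow> as \<in> E) \<or>
      (\<forall>as\<in>nlists n (ultraproduct F A). distinct as \<longrightarrow> as \<notin> E)"
  \<comment> \<open>The homogeneous sets may be of either kind in different factors; the ultrafilter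
    selects one kind for almost all of them.\<close>
  proof (cases "eventually (\<lambda>i. all_tuples_in n (B i) (A i)) F")
    case True
    have "as \<in> E" if as: "as \<in> nlists n (ultraproduct F A)" "distinct as" for as
      by (rule eventually_all_tuples_inD[OF F True as])
        (use B(2) class_tuple_in_iff[of _ n F B] in blast)
    then show ?thesis by blast
  next
    case False
    from ultrafilter_not_eventually[OF F False] P
    have neg: "eventually (\<lambda>i. all_tuples_in n (- B i) (A i)) F"
      by (rule eventually_elim2) (auto simp: homogeneous_def)
    have "as \<notin> E" if as: "as \<in> nlists n (ultraproduct F A)" "distinct as" for as
    proof (rule eventually_all_tuples_inD[OF F neg as])
      fix fs assume fs: "as = map (\<lambda>f. ae_eq F `` {f}) fs" "length fs = n"
        "eventually (\<lambda>i. map (\<lambda>f. f i) fs \<in> - B i) F"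
      show "as \<notin> E"
      proof
        assume "as \<in> E"
        then have "eventually (\<lambda>i. map (\<lambda>f. f i) fs \<in> B i) F"
          using class_tuple_in_iff[OF fs(2), of F B] fs(1) B(2) by simp
        with fs(3) have "eventually (\<lambda>i. False) F" by (rule eventually_elim2) blast
        then show False using F by (simp add: ultrafilter_def)
      qed
    qed
    then show ?thesis by blast
  qed
  ultimately show ?thesis by blast
qed

end
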